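(* Let $(\mathcal{X},d_{\mathcal{X}})$ be a finite metric space with $d_{\mathcal{X}}\le1$. Let $\epsilon>0$, $\delta\in(0,1)$, $r\in[0,1]$, let $s\ge1$ be an integer, and set $$\alpha=\frac{\epsilon}{(1+\sqrt2)\,r+\frac3s\ln(\frac1\delta)} .$$ 1. (Local model.) If $\mathcal{A}$ satisfies $(\alpha,\delta)$-bounded local $d_{\mathsf{EM}}$-DP, then the mechanism which, on input a dataset $K$ of arbitrary size, draws $s$ independent uniform samples with replacement from $K$ to form a dataset $L$ and outputs $\mathcal{A}(L)$, satisfies $(\epsilon,2\delta,r)$-discrete local $d_{\mathsf{EM}}$-DP. 2. (Central model.) If $\mathcal{A}$ satisfies $(\alpha,\delta)$-bounded central $d_{\mathsf{EM}}$-DP for $n$ users, then the mechanism which, on input user datasets $K_1,\dots,K_n$ of arbitrary sizes, independently for each user $i$ draws $s$ independent uniform samples with replacement from $K_i$ to form $L_i$, and outputs $\mathcal{A}(L_1\cup\dots\cup L_n)$, satisfies $(\epsilon,2\delta,r)$-discrete central $d_{\mathsf{EM}}$-DP.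
   Context: A dataset is a nonempty finite multiset of elements of $\mathcal{X}$; $\mathcal{X}^*$ is the set of all datasets; $\tilde K$ is the empirical distribution of $K$, $\tilde K[x]=(\text{number of occurrences of }x\text{ in }K)/|K|$. The earth-mover's distance is $d_{\mathsf{EM}}(P,Q)=\inf_C\mathbb{E}_{(x,x')\sim C}[d_{\mathcal{X}}(x,x')]$ over couplings $C$ of $P,Q$. $(\alpha,\delta)$-bounded local $d_{\mathsf{EM}}$-DP: for all datasets $K,K'$ with $|K|=|K'|$ and all measurable $O$, $\Pr[\mathcal{A}(K)\in O]\le e^{\alpha d_{\mathsf{EM}}(\tilde K,\tilde K')}\Pr[\mathcal{A}(K')\in O]+\delta$. $(\alpha,\delta)$-bounded central $d_{\mathsf{EM}}$-DP: each of $n$ users holds a dataset $K_i$ of the same fixed size (here $s$), $K_G=K_1\cup\dots\cup K_n$; for all $K_G,K_G'$ where $K_G'$ is obtained from $K_G$ by changing a single user's dataset $K_i$ to $K_i'$ of the same size, and all measurable $O$, $\Pr[\mathcal{A}(K_G)\in O]\le e^{\alpha d_{\mathsf{EM}}(\tilde K_i,\tilde K_i')}\Pr[\mathcal{A}(K_G')\in O]+\delta$. $(\epsilon,\delta,r)$-discrete local $d_{\mathsf{EM}}$-DP: for all $K,K'\in\mathcal{X}^*$ with $d_{\mathsf{EM}}(\tilde K,\tilde K')\le r$ and all measurable $O$, $\Pr[\mathcal{M}(K)\in O]\le e^{\epsilon}\Pr[\mathcal{M}(K')\in O]+\delta$. $(\epsilon,\delta,r)$-discrete central $d_{\mathsf{EM}}$-DP: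 for all families $(K_1,\dots,K_n)$ of datasets of any sizes, and all families obtained from it by changing a single $K_i$ to some $K_i'\in\mathcal{X}^*$ with $d_{\mathsf{EM}}(\tilde K_i,\tilde K_i')\le r$, writing $K_G,K_G'$ for the two global datasets, $\Pr[\mathcal{M}(K_G)\in O]\le e^{\epsilon}\Pr[\mathcal{M}(K_G')\in O]+\delta$ for all measurable $O$. (The mechanism is given the partition of $K_G$ into the users' datasets.) *)

theory Defs
  imports "HOL-Probability.Probability"
begin

text \<open>The empirical distribution of a dataset \<open>K\<close> is the library's \<^const>\<open>pmf_of_multiset\<close>, which is
  unspecified at the empty multiset.\<close>

definition datasets :: "'a multiset set" where
  "datasets = {K. K \<noteq> {#}}"

definition couplings :: "'a pmf \<Rightarrow> 'a pmf \<Rightarrow> ('a \<times> 'a) pmf set" where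
  "couplings P Q = {C. map_pmf fst C = P \<and> map_pmf snd C = Q}"

definition d_EM :: "'a::metric_space pmf \<Rightarrow> 'a pmf \<Rightarrow> real" where
  "d_EM P Q = (INF C\<in>couplings P Q. measure_pmf.expectation C (\<lambda>(x, x'). dist x x'))"

text \<open>A global dataset is the family of the users' datasets, i.e. \<open>K\<^sub>1 \<union> \<dots> \<union> K\<^sub>n\<close> together with
  its partition. Users are indexed by \<open>{..<n}\<close>; the padding value \<open>{#}\<close> outside this range makes
  such functions correspond exactly to \<open>n\<close>-tuples. A mechanism \<open>A\<close> that sees only the pooled
  multiset is the special case \<open>\<lambda>K. A (\<Sum>i<n. K i)\<close>.\<close>

definition families :: "nat \<Rightarrow> 'a multiset set \<Rightarrow> (nat \<Rightarrow> 'a multiset) set" where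
  "families n D = PiE_dflt {..<n} {#} (\<lambda>_. D)"

text \<open>A randomised mechanism with inputs in \<open>D\<close> and outputs in the measurable space \<open>N\<close> is given by
  its output distributions; it is unconstrained outside \<open>D\<close>.\<close>

definition mechanism :: "'k set \<Rightarrow> 'b measure \<Rightarrow> ('k \<Rightarrow> 'b measure) \<Rightarrow> bool" where
  "mechanism D N A \<longleftrightarrow> (\<forall>K\<in>D. prob_space (A K) \<and> sets (A K) = sets N)"

definition bounded_local_DP ::
  "'b measure \<Rightarrow> real \<Rightarrow> real \<Rightarrow> ('a::metric_space multiset \<Rightarrow> 'b measure) \<Rightarrow> bool" where
  "bounded_local_DP N \<alpha> \<delta> A \<longleftrightarrow>
     mechanism datasets N A \<and>
     (\<forall>K\<in>datasets. \<forall>K'\<in>datasets. size K = size K' \<longrightarrow>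
        (\<forall>S\<in>sets N. measure (A K) S \<le>
           exp (\<alpha> * d_EM (pmf_of_multiset K) (pmf_of_multiset K')) * measure (A K') S + \<delta>))"

definition bounded_central_DP ::
  "nat \<Rightarrow> nat \<Rightarrow> 'b measure \<Rightarrow> real \<Rightarrow> real \<Rightarrow>
     ((nat \<Rightarrow> 'a::metric_space multiset) \<Rightarrow> 'b measure) \<Rightarrow> bool" where
  "bounded_central_DP n s N \<alpha> \<delta> A \<longleftrightarrow>
     mechanism (families n {K\<in>datasets. size K = s}) N A \<and>
     (\<forall>K\<in>families n {K\<in>datasets. size K = s}. \<forall>i<n. \<forall>K'\<in>datasets. size K' = s \<longrightarrow>
        (\<forall>S\<in>sets N. measure (A K) S \<le>
           exp (\<alpha> * d_EM (pmf_of_multiset (K i)) (pmf_of_multiset K')) * measure (A (K(i := K'))) S + \<delta>))"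

definition discrete_local_DP ::
  "'b measure \<Rightarrow> real \<Rightarrow> real \<Rightarrow> real \<Rightarrow> ('a::metric_space multiset \<Rightarrow> 'b measure) \<Rightarrow> bool" where
  "discrete_local_DP N \<epsilon> \<delta> r M \<longleftrightarrow>
     mechanism datasets N M \<and>
     (\<forall>K\<in>datasets. \<forall>K'\<in>datasets. d_EM (pmf_of_multiset K) (pmf_of_multiset K') \<le> r \<longrightarrow>
        (\<forall>S\<in>sets N. measure (M K) S \<le> exp \<epsilon> * measure (M K') S + \<delta>))"

definition discrete_central_DP ::
  "nat \<Rightarrow> 'b measure \<Rightarrow> real \<Rightarrow> real \<Rightarrow> real \<Rightarrow>
     ((nat \<Rightarrow> 'a::metric_space multiset) \<Rightarrow> 'b measure) \<Rightarrow> bool" where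
  "discrete_central_DP n N \<epsilon> \<delta> r M \<longleftrightarrow>
     mechanism (families n datasets) N M \<and>
     (\<forall>K\<in>families n datasets. \<forall>i<n. \<forall>K'\<in>datasets.
        d_EM (pmf_of_multiset (K i)) (pmf_of_multiset K') \<le> r \<longrightarrow>
        (\<forall>S\<in>sets N. measure (M K) S \<le> exp \<epsilon> * measure (M (K(i := K'))) S + \<delta>))"

text \<open>The output distribution of drawing \<open>L\<close> from \<open>p\<close> and running \<open>A\<close> on \<open>L\<close>. The restriction to the
  support is needed because \<open>A\<close> need not be a measure on the intended output space elsewhere, in
  which case the plain monadic bind would be unspecified.\<close>

definition run_on :: "'k pmf \<Rightarrow> ('k \<Rightarrow> 'b measure) \<Rightarrow> 'b measure" where
  "run_on p A = restrict_space (measure_pmf p) (set_pmf p) \<bind> A"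

lemma emeasure_run_on:
  assumes "mechanism (set_pmf p) N A" and "S \<in> sets N"
  shows "emeasure (run_on p A) S = (\<integral>\<^sup>+L. emeasure (A L) S \<partial>measure_pmf p)"
proof -
  let ?R = "restrict_space (measure_pmf p) (set_pmf p)"
  have sets: "sets ?R = sets (count_space (set_pmf p))"
    by (auto simp: sets_restrict_space)
  have "A \<in> measurable (count_space (set_pmf p)) (subprob_algebra N)"
    using assms(1) by (auto simp: mechanism_def space_subprob_algebra prob_space_imp_subprob_space)
  then have "A \<in> measurable ?R (subprob_algebra N)"
    by (simp cong: measurable_cong_sets add: measurable_cong_sets[OF sets refl])
  then have "emeasure (run_on p A) S = (\<integral>\<^sup>+L. emeasure (A L) S \<partial>?R)"
    unfolding run_on_def using assms(2)
    by (intro emeasure_bind) (auto simp: space_restrict_space set_pmf_not_empty)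
  also have "\<dots> = (\<integral>\<^sup>+L. emeasure (A L) S * indicator (set_pmf p) L \<partial>measure_pmf p)"
    by (subst nn_integral_restrict_space) auto
  also have "\<dots> = (\<integral>\<^sup>+L. emeasure (A L) S \<partial>measure_pmf p)"
    by (intro nn_integral_cong_AE) (auto simp: AE_measure_pmf_iff)
  finally show ?thesis .
qed

definition resample :: "nat \<Rightarrow> 'a multiset \<Rightarrow> 'a multiset pmf" where
  "resample s K = map_pmf mset (replicate_pmf s (pmf_of_multiset K))"

definition local_sampling ::
  "nat \<Rightarrow> ('a multiset \<Rightarrow> 'b measure) \<Rightarrow> 'a multiset \<Rightarrow> 'b measure" where
  "local_sampling s A K = run_on (resample s K) A"

definition central_sampling ::
  "nat \<Rightarrow> nat \<Rightarrow> ((nat \<Rightarrow> 'a multiset) \<Rightarrow> 'b measure) \<Rightarrow> (nat \<Rightarrow> 'a multiset) \<Rightarrow> 'b measure" where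
  "central_sampling n s A K = run_on (Pi_pmf {..<n} {#} (\<lambda>i. resample s (K i))) A"

end

theory Submission
  imports Defs
begin

text \<open>Sampling \<open>s\<close> i.i.d. pairs from a near-optimal coupling of the empirical distributions couples the two
  resampled datasets \<open>L\<close>, \<open>L'\<close>, and \<open>d_EM\<close> of these is at most the average distance of the drawn
  pairs, whose mean is essentially at most \<open>r\<close>. A Chernoff bound shows that this average exceeds
  \<open>(1 + \<surd>2) r + (3/s) ln (1/\<delta>)\<close> with probability at most \<open>\<delta>\<close>; otherwise the privacy of the base
  mechanism costs a factor of at most \<open>e\<^sup>\<epsilon>\<close>. In the central model this argument is applied
  to the changed user, conditionally on the samples of all the others.\<close>

section \<open>Couplings and the earth-mover's distance\<close>

lemma d_EM_le:
  assumes "C \<in> couplings P Q"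
  shows "d_EM P Q \<le> measure_pmf.expectation C (\<lambda>(x, x'). dist x x')"
  unfolding d_EM_def
  by (rule cINF_lower[OF _ assms]) (auto intro!: bdd_belowI[of _ 0] integral_nonneg_AE)

text \<open>Independent draws couple any two distributions. This is needed to extract a near-optimal
  coupling from \<open>d_EM\<close>: over the reals, \<open>cInf_lessD\<close> requires a nonempty
  set.\<close>

lemma couplings_nonempty: "couplings P Q \<noteq> {}"
proof -
  have "pair_pmf P Q \<in> couplings P Q"
    by (simp add: couplings_def map_fst_pair_pmf map_snd_pair_pmf)
  then show ?thesis
    by blast
qed

lemma d_EM_less_obtain_coupling:
  assumes "d_EM P Q < b"
  obtains C where "C \<in> couplings P Q" "measure_pmf.expectation C (\<lambda>(x, x'). dist x x') < b"
  using assms cInf_lessD[OF _ assms[unfolded d_EM_def]] couplings_nonempty by blast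

text \<open>Drawing a uniform position instead of an element accounts for multiplicities, and it
  lets two lists of equal length share one random index.\<close>

lemma pmf_of_multiset_mset:
  assumes "xs \<noteq> []"
  shows "pmf_of_multiset (mset xs) = map_pmf (nth xs) (pmf_of_set {..<length xs})"
proof -
  have "image_mset (nth xs) (mset_set {..<length xs}) = mset xs"
    by (metis atLeast0LessThan map_nth mset_map mset_set_upto_eq_mset_upto)
  then show ?thesis
    using assms by (subst map_pmf_of_set) (auto simp: lessThan_empty_iff)
qed

text \<open>One uniform index into \<open>zs\<close>, read through \<open>fst\<close> and
  \<open>snd\<close>, couples the two empirical distributions; its expected cost is the average
  distance of the pairs.\<close>

lemma d_EM_mset_le:
  fixes zs :: "('a::metric_space \<times> 'a) list"
  assumes "zs \<noteq> []"
  shows "d_EM (pmf_of_multiset (mset (map fst zs))) (pmf_of_multiset (mset (map snd zs)))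
           \<le> (\<Sum>(x, x')\<leftarrow>zs. dist x x') / real (length zs)"
proof -
  let ?U = "pmf_of_set {..<length zs}"
  have map: "map_pmf f (map_pmf (nth zs) ?U) = pmf_of_multiset (mset (map f zs))"
    for f :: "'a \<times> 'a \<Rightarrow> 'a"
    using assms
    by (subst pmf_of_multiset_mset)
       (auto simp: pmf.map_comp lessThan_empty_iff simp del: mset_map intro!: map_pmf_cong)
  have "d_EM (pmf_of_multiset (mset (map fst zs))) (pmf_of_multiset (mset (map snd zs)))
          \<le> measure_pmf.expectation (map_pmf (nth zs) ?U) (\<lambda>(x, x'). dist x x')"
    by (intro d_EM_le) (simp add: couplings_def map)
  also have "\<dots> = (\<Sum>i<length zs. case zs ! i of (x, x') \<Rightarrow> dist x x') / real (length zs)"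
    using assms by (simp add: integral_pmf_of_set lessThan_empty_iff)
  also have "(\<Sum>i<length zs. case zs ! i of (x, x') \<Rightarrow> dist x x') = (\<Sum>(x, x')\<leftarrow>zs. dist x x')"
    by (simp add: sum_list_sum_nth atLeast0LessThan)
  finally show ?thesis .
qed

section \<open>Concentration of sums of i.i.d. samples\<close>

lemma map_pmf_replicate_pmf:
  "map_pmf (map f) (replicate_pmf n p) = replicate_pmf n (map_pmf f p)"
proof (induction n)
  case (Suc n)
  then show ?case
    by (simp add: map_bind_pmf bind_map_pmf flip: Suc.IH)
qed simp

text \<open>Independence makes the moment generating function factorise. Nonnegative integrals keep
  the induction free of integrability conditions.\<close>

lemma nn_integral_replicate_pmf_exp:
  fixes f :: "'a \<Rightarrow> real"
  shows "(\<integral>\<^sup>+xs. ennreal (exp (\<Sum>x\<leftarrow>xs. f x)) \<partial>measure_pmf (replicate_pmf n p))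
           = (\<integral>\<^sup>+x. ennreal (exp (f x)) \<partial>measure_pmf p) ^ n"
  by (induction n) (simp_all add: exp_add ennreal_mult nn_integral_cmult nn_integral_multc)

text \<open>Exponential Markov inequality with the exponent parameter fixed at 1.\<close>

lemma chernoff_replicate_pmf:
  fixes f :: "'a \<Rightarrow> real"
  assumes "\<And>x. 0 \<le> f x" "\<And>x. f x \<le> 1" and mean: "measure_pmf.expectation p f \<le> \<mu>"
  shows "emeasure (measure_pmf (replicate_pmf n p)) {xs. (\<Sum>x\<leftarrow>xs. f x) \<ge> t}
           \<le> ennreal (exp (real n * (exp 1 - 1) * \<mu> - t))"
proof -
  let ?S = "\<lambda>xs. \<Sum>x\<leftarrow>xs. f x"
  have int: "integrable (measure_pmf p) f"
    using assms by (intro measure_pmf.integrable_const_bound[where B=1]) auto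
  \<comment> \<open>\<open>exp\<close> lies below its chord over [0, 1]; \<open>f x\<close> is the
    convex weight of the endpoint 1.\<close>
  have chord: "exp (f x) \<le> 1 + (exp 1 - 1) * f x" for x
    using convex_onD[OF exp_convex, of "f x" 0 1] assms by (simp add: algebra_simps)
  have "(\<integral>\<^sup>+x. ennreal (exp (f x)) \<partial>measure_pmf p)
          \<le> (\<integral>\<^sup>+x. ennreal (1 + (exp 1 - 1) * f x) \<partial>measure_pmf p)"
    by (intro nn_integral_mono ennreal_leI chord)
  also have "\<dots> = ennreal (measure_pmf.expectation p (\<lambda>x. 1 + (exp 1 - 1) * f x))"
    using int assms by (intro nn_integral_eq_integral) auto
  also have "measure_pmf.expectation p (\<lambda>x. 1 + (exp 1 - 1) * f x)
               = 1 + (exp 1 - 1) * measure_pmf.expectation p f"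
    using int by simp
  \<comment> \<open>\<open>1 + y \<le> exp y\<close> turns the bound for one sample into an
    exponential, whose \<open>n\<close>-th power is explicit.\<close>
  also have "ennreal \<dots> \<le> ennreal (exp ((exp 1 - 1) * \<mu>))"
    using mean
    by (intro ennreal_leI order_trans[OF _ exp_ge_add_one_self] add_left_mono mult_left_mono) auto
  finally have mgf: "(\<integral>\<^sup>+x. ennreal (exp (f x)) \<partial>measure_pmf p) \<le> ennreal (exp ((exp 1 - 1) * \<mu>))" .
  have "emeasure (measure_pmf (replicate_pmf n p)) {xs. ?S xs \<ge> t}
          = (\<integral>\<^sup>+xs. indicator {xs. ?S xs \<ge> t} xs \<partial>measure_pmf (replicate_pmf n p))"
    by simp
  \<comment> \<open>Markov's argument: where \<open>t \<le> ?S xs\<close>, the indicator is at most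
    \<open>exp (?S xs - t)\<close>.\<close>
  also have "\<dots> \<le> (\<integral>\<^sup>+xs. ennreal (exp (-t)) * ennreal (exp (?S xs)) \<partial>measure_pmf (replicate_pmf n p))"
    by (intro nn_integral_mono) (auto simp: indicator_def simp flip: ennreal_mult exp_add)
  also have "\<dots> = ennreal (exp (-t)) * (\<integral>\<^sup>+x. ennreal (exp (f x)) \<partial>measure_pmf p) ^ n"
    by (simp add: nn_integral_cmult nn_integral_replicate_pmf_exp)
  also have "\<dots> \<le> ennreal (exp (-t)) * ennreal (exp ((exp 1 - 1) * \<mu>)) ^ n"
    by (intro mult_left_mono power_mono mgf) auto
  also have "\<dots> = ennreal (exp (real n * (exp 1 - 1) * \<mu> - t))"
    by (simp add: ennreal_power algebra_simps flip: ennreal_mult exp_of_nat_mult exp_add)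
  finally show ?thesis .
qed

section \<open>Comparing resampled datasets through a coupling\<close>

lemma nn_integral_coupling_le:
  fixes f :: "'k \<Rightarrow> ennreal"
  assumes "\<And>z. z \<in> set_pmf R \<Longrightarrow> z \<notin> B \<Longrightarrow> f (u z) \<le> c * f (v z) + d"
    and "\<And>z. z \<in> set_pmf R \<Longrightarrow> f (u z) \<le> 1"
  shows "(\<integral>\<^sup>+x. f x \<partial>measure_pmf (map_pmf u R))
           \<le> c * (\<integral>\<^sup>+x. f x \<partial>measure_pmf (map_pmf v R)) + d + emeasure (measure_pmf R) B"
proof -
  have "(\<integral>\<^sup>+x. f x \<partial>measure_pmf (map_pmf u R)) = (\<integral>\<^sup>+z. f (u z) \<partial>measure_pmf R)"
    by simp
  \<comment> \<open>Off \<open>B\<close> the pointwise comparison applies; on \<open>B\<close> the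
    indicator pays for \<open>f (u z) \<le> 1\<close>.\<close>
  also have "\<dots> \<le> (\<integral>\<^sup>+z. c * f (v z) + d + indicator B z \<partial>measure_pmf R)"
  proof (intro nn_integral_mono_AE AE_pmfI)
    fix z assume "z \<in> set_pmf R"
    with assms[of z] show "f (u z) \<le> c * f (v z) + d + indicator B z"
      by (cases "z \<in> B") (auto intro: add_increasing)
  qed
  also have "\<dots> = c * (\<integral>\<^sup>+x. f x \<partial>measure_pmf (map_pmf v R)) + d + emeasure (measure_pmf R) B"
    by (simp add: nn_integral_add nn_integral_cmult)
  finally show ?thesis .
qed

lemma set_pmf_resampleD:
  assumes "L \<in> set_pmf (resample s K)"
  shows "size L = s"
  using assms by (auto simp: resample_def set_replicate_pmf)

lemma resample_map_pmf:
  assumes "map_pmf f C = pmf_of_multiset K"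
  shows "resample s K = map_pmf (\<lambda>zs. mset (map f zs)) (replicate_pmf s C)"
  by (simp add: resample_def pmf.map_comp o_def flip: assms map_pmf_replicate_pmf)

text \<open>An abstract \<open>f\<close> serves both models: \<open>f L\<close> will be the
  probability of an output event when the changed user's sample is \<open>L\<close>. One
  \<open>\<delta>\<close> comes from the hypothesis \<open>le\<close>, the other from the event that
  the sampled pairs are too far apart on average.\<close>

lemma nn_integral_resample_le:
  fixes K K' :: "'a::metric_space multiset" and f :: "'a multiset \<Rightarrow> ennreal"
  assumes diam: "\<And>x y :: 'a. dist x y \<le> 1"
    and \<delta>: "0 < \<delta>" "\<delta> < 1" and "0 \<le> r" and "s \<ge> 1"
    and dist: "d_EM (pmf_of_multiset K) (pmf_of_multiset K') \<le> r"
    and le1: "\<And>L. size L = s \<Longrightarrow> f L \<le> 1"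
    and le: "\<And>L L'. size L = s \<Longrightarrow> size L' = s \<Longrightarrow>
      d_EM (pmf_of_multiset L) (pmf_of_multiset L') \<le> (1 + sqrt 2) * r + 3 / real s * ln (1 / \<delta>) \<Longrightarrow>
      f L \<le> c * f L' + ennreal \<delta>"
  shows "(\<integral>\<^sup>+L. f L \<partial>measure_pmf (resample s K))
           \<le> c * (\<integral>\<^sup>+L. f L \<partial>measure_pmf (resample s K')) + ennreal (2 * \<delta>)"
proof -
  define l where "l = ln (1 / \<delta>)"
  define a where "a = (1 + sqrt 2) * r + 3 / real s * l"
  have l: "l > 0" and exp_l: "exp (-l) = \<delta>"
    using \<delta> by (simp_all add: l_def ln_div exp_minus)
  \<comment> \<open>The infimum \<open>d_EM\<close> need not be assumed attained: the constant 3 leaves room for the excess.\<close>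
  have "d_EM (pmf_of_multiset K) (pmf_of_multiset K') < r + l / real s"
    using dist l \<open>s \<ge> 1\<close> by (intro le_less_trans[OF dist]) auto
  then obtain C where C: "C \<in> couplings (pmf_of_multiset K) (pmf_of_multiset K')"
    and mean: "measure_pmf.expectation C (\<lambda>(x, x'). dist x x') < r + l / real s"
    by (rule d_EM_less_obtain_coupling)
  let ?R = "replicate_pmf s C"
  define B where "B = {zs :: ('a \<times> 'a) list. (\<Sum>(x, x')\<leftarrow>zs. dist x x') \<ge> real s * a}"
  have res: "resample s K = map_pmf (\<lambda>zs. mset (map fst zs)) ?R"
            "resample s K' = map_pmf (\<lambda>zs. mset (map snd zs)) ?R"
    using C resample_map_pmf[of fst C K s] resample_map_pmf[of snd C K' s]
    by (auto simp: couplings_def)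
  have "emeasure (measure_pmf ?R) B
          \<le> ennreal (exp (real s * (exp 1 - 1) * (r + l / real s) - real s * a))"
    unfolding B_def using mean diam by (intro chernoff_replicate_pmf) auto
  \<comment> \<open>The term in \<open>r\<close> is covered by
    \<open>exp 1 - 1 \<le> 2 \<le> 1 + sqrt 2\<close>. Of the \<open>3 * l\<close> in
    \<open>real s * a\<close>, two parts absorb the excess \<open>l / real s\<close> in the mean and
    the third remains as the exponent \<open>-l\<close>.\<close>
  also have "\<dots> \<le> ennreal (exp (-l))"
  proof (intro ennreal_leI, subst exp_le_cancel_iff)
    have e: "exp 1 - 1 \<le> (2::real)"
      using exp_le by simp
    have "real s * (exp 1 - 1) * (r + l / real s) = (exp 1 - 1) * (real s * r + l)"
      using \<open>s \<ge> 1\<close> by (simp add: field_simps)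
    also have "\<dots> \<le> 2 * (real s * r + l)"
      using e l \<open>0 \<le> r\<close> by (intro mult_right_mono) auto
    also have "\<dots> = 2 * (real s * r) + 2 * l"
      by simp
    also have "\<dots> \<le> (1 + sqrt 2) * (real s * r) + 2 * l"
      using \<open>0 \<le> r\<close> by (intro add_right_mono mult_right_mono) auto
    also have "\<dots> = real s * a - l"
      using \<open>s \<ge> 1\<close> by (simp add: a_def field_simps)
    finally show "real s * (exp 1 - 1) * (r + l / real s) - real s * a \<le> -l"
      by simp
  qed
  finally have B: "emeasure (measure_pmf ?R) B \<le> ennreal \<delta>"
    by (simp add: exp_l)
  have "(\<integral>\<^sup>+L. f L \<partial>measure_pmf (resample s K))
          \<le> c * (\<integral>\<^sup>+L. f L \<partial>measure_pmf (resample s K')) + ennreal \<delta> + emeasure (measure_pmf ?R) B"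
    unfolding res
  proof (rule nn_integral_coupling_le)
    fix zs assume "zs \<in> set_pmf ?R"
    then have len: "length zs = s"
      by (simp add: set_replicate_pmf)
    then show "f (mset (map fst zs)) \<le> 1"
      by (intro le1) simp
    assume "zs \<notin> B"
    then have "(\<Sum>(x, x')\<leftarrow>zs. dist x x') / real s \<le> a"
      using \<open>s \<ge> 1\<close> by (auto simp: B_def field_simps)
    moreover have "zs \<noteq> []"
      using len \<open>s \<ge> 1\<close> by auto
    ultimately show "f (mset (map fst zs)) \<le> c * f (mset (map snd zs)) + ennreal \<delta>"
      using d_EM_mset_le[of zs] len by (intro le) (auto simp: a_def l_def)
  qed
  also have "\<dots> \<le> c * (\<integral>\<^sup>+L. f L \<partial>measure_pmf (resample s K')) + ennreal \<delta> + ennreal \<delta>"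
    by (intro add_left_mono B)
  also have "\<dots> = c * (\<integral>\<^sup>+L. f L \<partial>measure_pmf (resample s K')) + ennreal (2 * \<delta>)"
    using \<delta> by (simp add: add.assoc flip: ennreal_plus)
  finally show ?thesis .
qed

section \<open>Output distributions of mechanisms\<close>

lemma mechanism_subset: "mechanism D N A \<Longrightarrow> D' \<subseteq> D \<Longrightarrow> mechanism D' N A"
  by (auto simp: mechanism_def)

lemma mechanism_emeasure_le_1:
  assumes "mechanism D N A" "K \<in> D"
  shows "emeasure (A K) S \<le> 1"
  using assms by (auto simp: mechanism_def intro: prob_space.emeasure_le_1)

text \<open>Total mass 1 survives because it is averaged over \<open>p K\<close>; only the support
  of \<open>p K\<close> matters for this average.\<close>

lemma mechanism_run_on:
  assumes "\<And>K. K \<in> D \<Longrightarrow> mechanism (set_pmf (p K)) N A"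
  shows "mechanism D N (\<lambda>K. run_on (p K) A)"
  unfolding mechanism_def
proof (intro ballI conjI)
  fix K assume K: "K \<in> D"
  note A = assms[OF K]
  show sets: "sets (run_on (p K) A) = sets N"
    unfolding run_on_def using A
    by (intro sets_bind) (auto simp: mechanism_def space_restrict_space set_pmf_not_empty)
  have "emeasure (run_on (p K) A) (space N) = (\<integral>\<^sup>+L. emeasure (A L) (space N) \<partial>measure_pmf (p K))"
    by (rule emeasure_run_on[OF A]) simp
  also have "\<dots> = (\<integral>\<^sup>+L. 1 \<partial>measure_pmf (p K))"
  proof (intro nn_integral_cong_AE AE_pmfI)
    fix L assume "L \<in> set_pmf (p K)"
    with A have "prob_space (A L)" "sets (A L) = sets N"
      by (auto simp: mechanism_def)
    then show "emeasure (A L) (space N) = 1"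
      by (metis prob_space.emeasure_space_1 sets_eq_imp_space_eq)
  qed
  finally show "prob_space (run_on (p K) A)"
    using sets_eq_imp_space_eq[OF sets] by (intro prob_spaceI) simp
qed

text \<open>Bridge between the privacy definitions, stated with the real-valued
  \<open>measure\<close>, and the averaging arguments, carried out in \<open>ennreal\<close>;
  finiteness of the output measures makes the two agree.\<close>

lemma mechanism_measure_le_iff:
  assumes "mechanism D N A" "K \<in> D" "K' \<in> D" "0 \<le> c" "0 \<le> d"
  shows "measure (A K) S \<le> c * measure (A K') S + d \<longleftrightarrow>
         emeasure (A K) S \<le> ennreal c * emeasure (A K') S + ennreal d"
proof -
  have "emeasure (A L) S = ennreal (measure (A L) S)" if "L \<in> D" for L
    using assms(1) that
    by (auto simp: mechanism_def intro!: finite_measure.emeasure_eq_measure prob_space.finite_measure)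
  then show ?thesis
    using assms by (simp flip: ennreal_mult ennreal_plus)
qed

theorem theorem5p3:
  fixes \<epsilon> \<delta> r \<alpha> :: real and s n :: nat and N :: "'b measure"
    and A\<^sub>l :: "'a::{finite, metric_space} multiset \<Rightarrow> 'b measure"
    and A\<^sub>c :: "(nat \<Rightarrow> 'a multiset) \<Rightarrow> 'b measure"
  assumes "\<And>x y :: 'a. dist x y \<le> 1"
    and "\<epsilon> > 0" and "0 < \<delta>" and "\<delta> < 1" and "0 \<le> r" and "r \<le> 1" and "s \<ge> 1"
    and "\<alpha> = \<epsilon> / ((1 + sqrt 2) * r + 3 / real s * ln (1 / \<delta>))"
  shows "(bounded_local_DP N \<alpha> \<delta> A\<^sub>l \<longrightarrow>
            discrete_local_DP N \<epsilon> (2 * \<delta>) r (local_sampling s A\<^sub>l)) \<and>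
         (bounded_central_DP n s N \<alpha> \<delta> A\<^sub>c \<longrightarrow>
            discrete_central_DP n N \<epsilon> (2 * \<delta>) r (central_sampling n s A\<^sub>c))"
proof (intro conjI impI)
  define a where "a = (1 + sqrt 2) * r + 3 / real s * ln (1 / \<delta>)"
  have "ln (1 / \<delta>) > 0"
    using assms by simp
  \<comment> \<open>The logarithmic term keeps the denominator of \<open>\<alpha>\<close> positive
    even for \<open>r = 0\<close>.\<close>
  then have "a > 0"
    using assms by (auto simp: a_def intro!: add_nonneg_pos)
  \<comment> \<open>As \<open>\<alpha> * a = \<epsilon>\<close>, a distance of at most
    \<open>a\<close> costs a factor of at most \<open>exp \<epsilon>\<close>.\<close>
  then have exp_le: "exp (\<alpha> * d) * m + \<delta> \<le> exp \<epsilon> * m + \<delta>" if "d \<le> a" "m \<ge> 0" for d m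
  proof -
    have "\<alpha> * d \<le> \<epsilon>"
      using that(1) \<open>a > 0\<close> \<open>\<epsilon> > 0\<close> unfolding assms(8) a_def[symmetric] by (simp add: field_simps)
    then show ?thesis
      using that(2) by (simp add: mult_right_mono)
  qed
  have dataset: "L \<in> datasets" if "size L = s" for L :: "'a multiset"
    using that \<open>s \<ge> 1\<close> by (auto simp: datasets_def)
  note resample_le = nn_integral_resample_le[OF assms(1) assms(3-5,7)]
  {

    \<comment> \<open>Local model\<close>
    assume DP: "bounded_local_DP N \<alpha> \<delta> A\<^sub>l"
    then have mech: "mechanism datasets N A\<^sub>l"
      by (simp add: bounded_local_DP_def)
    have mech_res: "mechanism (set_pmf (resample s K)) N A\<^sub>l" for K
      by (rule mechanism_subset[OF mech]) (auto dest: set_pmf_resampleD intro: dataset)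
    have mech_run: "mechanism datasets N (local_sampling s A\<^sub>l)"
      unfolding local_sampling_def by (rule mechanism_run_on) (rule mech_res)
    show "discrete_local_DP N \<epsilon> (2 * \<delta>) r (local_sampling s A\<^sub>l)"
      unfolding discrete_local_DP_def
    proof (intro conjI ballI impI mech_run)
      fix K K' :: "'a multiset" and S
      assume K: "K \<in> datasets" "K' \<in> datasets" and S: "S \<in> sets N"
        and dist: "d_EM (pmf_of_multiset K) (pmf_of_multiset K') \<le> r"
      have "emeasure (A\<^sub>l L) S \<le> ennreal (exp \<epsilon>) * emeasure (A\<^sub>l L') S + ennreal \<delta>"
        if "size L = s" "size L' = s" "d_EM (pmf_of_multiset L) (pmf_of_multiset L') \<le> a"
        for L L' :: "'a multiset"
      proof -
        have "measure (A\<^sub>l L) S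
                \<le> exp (\<alpha> * d_EM (pmf_of_multiset L) (pmf_of_multiset L')) * measure (A\<^sub>l L') S + \<delta>"
          using DP S that dataset by (auto simp: bounded_local_DP_def)
        also have "\<dots> \<le> exp \<epsilon> * measure (A\<^sub>l L') S + \<delta>"
          using that by (intro exp_le) auto
        finally show ?thesis
          using mechanism_measure_le_iff[OF mech, of L L' "exp \<epsilon>" \<delta>] dataset that assms(3) by simp
      qed
      \<comment> \<open>The comparison is instantiated with
        \<open>f L = emeasure (A\<^sub>l L) S\<close>.\<close>
      then have "emeasure (local_sampling s A\<^sub>l K) S
                   \<le> ennreal (exp \<epsilon>) * emeasure (local_sampling s A\<^sub>l K') S + ennreal (2 * \<delta>)"
        unfolding local_sampling_def emeasure_run_on[OF mech_res S]
        using dist mechanism_emeasure_le_1[OF mech] dataset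
        by (intro resample_le) (auto simp: a_def)
      then show "measure (local_sampling s A\<^sub>l K) S
                   \<le> exp \<epsilon> * measure (local_sampling s A\<^sub>l K') S + 2 * \<delta>"
        using mechanism_measure_le_iff[OF mech_run K, of "exp \<epsilon>" "2 * \<delta>"] assms(3) by simp
    qed
  next

    \<comment> \<open>Central model\<close>
    let ?F = "families n {K :: 'a multiset \<in> datasets. size K = s}"
    assume DP: "bounded_central_DP n s N \<alpha> \<delta> A\<^sub>c"
    then have mech: "mechanism ?F N A\<^sub>c"
      by (simp add: bounded_central_DP_def)
    have mech_res: "mechanism (set_pmf (Pi_pmf {..<n} {#} (\<lambda>i. resample s (K i)))) N A\<^sub>c" for K
      by (rule mechanism_subset[OF mech])
         (auto simp: set_Pi_pmf families_def PiE_dflt_def dest: set_pmf_resampleD intro!: dataset)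
    have mech_run: "mechanism (families n datasets) N (central_sampling n s A\<^sub>c)"
      unfolding central_sampling_def by (rule mechanism_run_on) (rule mech_res)
    show "discrete_central_DP n N \<epsilon> (2 * \<delta>) r (central_sampling n s A\<^sub>c)"
      unfolding discrete_central_DP_def
    proof (intro conjI ballI allI impI mech_run)
      fix K :: "nat \<Rightarrow> 'a multiset" and i K' S
      assume K: "K \<in> families n datasets" and i: "i < n" and K': "K' \<in> datasets"
        and S: "S \<in> sets N" and dist: "d_EM (pmf_of_multiset (K i)) (pmf_of_multiset K') \<le> r"
      \<comment> \<open>\<open>?M\<close> is the joint law of the other users' samples;
        \<open>?E L G\<close> is the output probability when these are \<open>G\<close> and user
        \<open>i\<close> draws \<open>L\<close>.\<close>
      let ?M = "Pi_pmf ({..<n} - {i}) {#} (\<lambda>j. resample s (K j))"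
      let ?E = "\<lambda>L G. emeasure (A\<^sub>c (G(i := L))) S"
      have upd: "G(i := L) \<in> ?F" if "G \<in> set_pmf ?M" "size L = s"
        for G and L :: "'a multiset"
        using that i dataset
        by (auto simp: set_Pi_pmf families_def PiE_dflt_def dest!: set_pmf_resampleD)
      \<comment> \<open>Fubini with user \<open>i\<close> drawn last. Since \<open>J\<close> agrees
        with \<open>K\<close> away from \<open>i\<close>, the same outer law \<open>?M\<close>
        serves both \<open>K\<close> and \<open>K(i := K')\<close>.\<close>
      have split: "emeasure (central_sampling n s A\<^sub>c J) S
              = (\<integral>\<^sup>+G. \<integral>\<^sup>+L. ?E L G \<partial>measure_pmf (resample s (J i)) \<partial>measure_pmf ?M)"
        if "\<And>j. j \<noteq> i \<Longrightarrow> J j = K j" for J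
      proof -
        have "Pi_pmf (insert i ({..<n} - {i})) {#} (\<lambda>j. resample s (J j))
                = map_pmf (\<lambda>(L, G). G(i := L)) (pair_pmf (resample s (J i))
                    (Pi_pmf ({..<n} - {i}) {#} (\<lambda>j. resample s (J j))))"
          by (rule Pi_pmf_insert) auto
        also have "Pi_pmf ({..<n} - {i}) {#} (\<lambda>j. resample s (J j)) = ?M"
          using that by (intro Pi_pmf_cong) auto
        also have "insert i ({..<n} - {i}) = {..<n}"
          using i by auto
        also have "map_pmf (\<lambda>(L, G). G(i := L)) (pair_pmf (resample s (J i)) ?M)
              = bind_pmf ?M (\<lambda>G. bind_pmf (resample s (J i)) (\<lambda>L. return_pmf (G(i := L))))"
          by (subst pair_commute_pmf)
             (simp add: pair_pmf_def map_pmf_def bind_assoc_pmf bind_return_pmf)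
        finally show ?thesis
          unfolding central_sampling_def emeasure_run_on[OF mech_res S] by simp
      qed
      have step: "?E L G \<le> ennreal (exp \<epsilon>) * ?E L' G + ennreal \<delta>"
        if G: "G \<in> set_pmf ?M" and size: "size L = s" "size L' = s"
          and le_a: "d_EM (pmf_of_multiset L) (pmf_of_multiset L') \<le> a" for G L L'
      proof -
        have "\<forall>J\<in>?F. \<forall>i<n. \<forall>J'\<in>datasets. size J' = s \<longrightarrow> (\<forall>S\<in>sets N. measure (A\<^sub>c J) S \<le>
            exp (\<alpha> * d_EM (pmf_of_multiset (J i)) (pmf_of_multiset J')) * measure (A\<^sub>c (J(i := J'))) S + \<delta>)"
          using DP unfolding bounded_central_DP_def by blast
        \<comment> \<open>The base family is \<open>G(i := L)\<close>; overwriting its entry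
          \<open>i\<close> by \<open>L'\<close> gives \<open>G(i := L')\<close>.\<close>
        from this[rule_format, OF upd[OF G size(1)] i dataset[OF size(2)] size(2) S]
        have "measure (A\<^sub>c (G(i := L))) S
            \<le> exp (\<alpha> * d_EM (pmf_of_multiset L) (pmf_of_multiset L')) * measure (A\<^sub>c (G(i := L'))) S + \<delta>"
          by simp
        also have "\<dots> \<le> exp \<epsilon> * measure (A\<^sub>c (G(i := L'))) S + \<delta>"
          using le_a by (intro exp_le) auto
        finally show ?thesis
          using mechanism_measure_le_iff[OF mech upd[OF G size(1)] upd[OF G size(2)], of "exp \<epsilon>" \<delta>]
            assms(3) by simp
      qed
      have "emeasure (central_sampling n s A\<^sub>c K) S
              = (\<integral>\<^sup>+G. \<integral>\<^sup>+L. ?E L G \<partial>measure_pmf (resample s (K i)) \<partial>measure_pmf ?M)"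
        by (rule split) simp
      \<comment> \<open>The comparison is applied for each fixed \<open>G\<close> in the support of
        \<open>?M\<close>, with \<open>f L = ?E L G\<close>.\<close>
      also have "\<dots> \<le> (\<integral>\<^sup>+G. ennreal (exp \<epsilon>) * (\<integral>\<^sup>+L. ?E L G \<partial>measure_pmf (resample s K'))
                            + ennreal (2 * \<delta>) \<partial>measure_pmf ?M)"
        using dist step mechanism_emeasure_le_1[OF mech upd]
        by (intro nn_integral_mono_AE AE_pmfI resample_le) (auto simp: a_def)
      \<comment> \<open>Averaging over \<open>G\<close> leaves the constant
        \<open>2 * \<delta>\<close> unchanged, as \<open>?M\<close> has mass 1.\<close>
      also have "\<dots> = ennreal (exp \<epsilon>) * emeasure (central_sampling n s A\<^sub>c (K(i := K'))) S
                        + ennreal (2 * \<delta>)"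
        by (subst split) (simp_all add: nn_integral_add nn_integral_cmult)
      finally show "measure (central_sampling n s A\<^sub>c K) S
                   \<le> exp \<epsilon> * measure (central_sampling n s A\<^sub>c (K(i := K'))) S + 2 * \<delta>"
        using mechanism_measure_le_iff[OF mech_run K, of "K(i := K')" "exp \<epsilon>" "2 * \<delta>"] K K' i assms(3)
        by (auto simp: families_def PiE_dflt_def)
    qed
  }
qed

end
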